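(* Let $p$ be a prime, let $k$ and $\lambda$ be positive integers and let $H$ be an abelian $p$-group of cardinality $p^{\lambda k}$. If there exists a finite commutative local artinian ring $A$ such that $A^*\cong\mathbb F_{p^\lambda}^*\times H$, then the exponent of $H$ is at most $p^k$.
   Context: Rings have an identity. $A^*$ denotes the group of units of a ring $A$, $\mathbb F_q$ denotes the finite field with $q$ elements, and $\mathbb F_q^*$ its multiplicative group.
   Formalization: The formal statement also assumes that the residue field of A has characteristic p; without this the claim fails (A = Z/13, p = 2, λ = 2, k = 1, H = C_4). The excluded rings always violate the bound if λ ≥ 2; if λ = 1 the bound is just exponent ≤ |H|. *)

theory Defs
  imports "HOL-Algebra.Algebra" "HOL-Computational_Algebra.Primes"
begin

(* The zero ring has no maximal ideal, hence is not local. *)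
locale local_ring = cring +
  assumes ex1_maximalideal: "\<exists>!M. maximalideal M R"

(* For commutative rings; two-sided ideals are used. *)
locale artinian_ring = cring +
  assumes descending_chain:
    "\<lbrakk>\<And>n::nat. ideal (I n) R; \<And>n. I (Suc n) \<subseteq> I n\<rbrakk> \<Longrightarrow> \<exists>N. \<forall>n\<ge>N. I n = I N"

(* The theorem asks p to vanish in the residue field of A, i.e. that A has residue
   characteristic p, as the appearance of F_{p^l} in the decomposition of the unit group is
   meant to convey. A mere isomorphism of abstract groups does not force this: the units of
   Z/13 form C_12 = C_3 x C_4, so for p = 2, l = 2, k = 1 one gets H = C_4, of exponent
   4 > 2. *)
definition residue_field :: "('a, 'm) ring_scheme \<Rightarrow> 'a set ring" where
  "residue_field A = A Quot (THE M. maximalideal M A)"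

definition p_group :: "nat \<Rightarrow> ('a, 'm) monoid_scheme \<Rightarrow> bool" where
  "p_group p G \<longleftrightarrow> group G \<and> (\<forall>x\<in>carrier G. \<exists>n::nat. group.ord G x = p ^ n)"

(* Meaningful only if some positive exponent kills G, in particular if G is finite;
   otherwise the LEAST is unspecified. *)
definition group_exponent :: "('a, 'm) monoid_scheme \<Rightarrow> nat" where
  "group_exponent G = (LEAST n. 0 < n \<and> (\<forall>x\<in>carrier G. x [^]\<^bsub>G\<^esub> n = \<one>\<^bsub>G\<^esub>))"

end

theory Submission
  imports Defs
begin

text \<open>
  Let \<open>A\<close> be a finite local ring of residue characteristic \<open>p\<close>, with maximal ideal \<open>M\<close> and
  residue field of order \<open>Q\<close>. Since \<open>p\<close> is nilpotent in \<open>A\<close>, the order of \<open>A\<close> is a power of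
  \<open>p\<close>, and hence so are \<open>Q\<close> and \<open>card M\<close>. The units of \<open>A\<close> are the elements outside \<open>M\<close>, so
  there are \<open>(Q - 1) * card M\<close> of them. Comparing with \<open>(p ^ l - 1) * p ^ (l * k)\<close>, where the
  \<open>p\<close>-parts and the prime-to-\<open>p\<close> parts must agree, gives \<open>Q = p ^ l\<close> and \<open>card M = Q ^ k\<close>
  (\<open>card_max_ideal_and_residue_field\<close>).

  A unit \<open>u\<close> coming from \<open>H\<close> satisfies \<open>u ^ (Q ^ k) = 1\<close>. In the residue field the
  \<open>Q\<close>-th power map is the identity, so \<open>u\<close> is congruent to 1 modulo \<open>M\<close>
  (\<open>unit_in_one_plus_max_ideal\<close>).

  It remains to see that \<open>(1 + x) ^ (p ^ k) = 1\<close> for \<open>x\<close> in \<open>M\<close>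
  (\<open>one_plus_max_ideal_pow\<close>). Put \<open>y i = (1 + x) ^ (p ^ i) - 1\<close>. As \<open>p\<close> lies in \<open>M\<close>,
  the identity \<open>(1 + y) ^ p = 1 + y * (p + y * c)\<close> shows \<open>y (i + 1) \<in> M * y i\<close>. Multiplication by
  \<open>a \<noteq> 0\<close> is an additive map whose kernel lies in \<open>M\<close>, so \<open>A * a\<close> is exactly \<open>Q\<close> times as
  large as \<open>M * a\<close> (\<open>card_principal_ideal\<close>). Hence each step with \<open>y i \<noteq> 0\<close> makes the principal
  ideal \<open>A * y i\<close> shrink at least by the factor \<open>Q\<close>. If \<open>y k\<close> were nonzero there would be
  \<open>k + 1\<close> such steps, starting inside \<open>M\<close>, and \<open>M\<close> has only \<open>Q ^ k\<close> elements.
\<close>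

section \<open>Counting in finite groups and finite fields\<close>

lemma prime_power_if_unique_prime_divisor:
  fixes n p :: nat
  assumes "n \<noteq> 0" "Factorial_Ring.prime p"
    and only: "\<And>r. Factorial_Ring.prime r \<Longrightarrow> r dvd n \<Longrightarrow> r = p"
  obtains i where "n = p ^ i"
proof -
  have "\<not> is_unit p" using assms(2) prime_gt_1_nat by fastforce
  from multiplicity_decompose'[OF assms(1) this]
  obtain m where m: "n = p ^ multiplicity p n * m" "\<not> p dvd m" by metis
  have "m = 1"
  proof (rule ccontr)
    assume "m \<noteq> 1"
    then obtain r where "Factorial_Ring.prime r" "r dvd m"
      using prime_factor_nat by blast
    moreover from this have "r dvd n" using m(1) by (metis dvd_mult)
    ultimately show False using only m(2) by blast
  qed
  with m(1) show thesis using that by simp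
qed

text \<open>
  A finite group in which \<open>p ^ N\<close> kills every element has order a power of \<open>p\<close>: for each prime
  divisor \<open>r\<close> of the order, a subgroup of order \<open>r\<close> contains an element of order \<open>r\<close>.
\<close>

lemma (in group) order_prime_power:
  assumes fin: "finite (carrier G)" and p: "Factorial_Ring.prime p"
    and tors: "\<And>x. x \<in> carrier G \<Longrightarrow> x [^] (p ^ N :: nat) = \<one>"
  obtains i where "order G = p ^ i"
proof (rule prime_power_if_unique_prime_divisor[of "order G" p])
  show "order G \<noteq> 0" using fin order_gt_0_iff_finite by simp
next
  fix r :: nat assume r: "Factorial_Ring.prime r" "r dvd order G"
  then obtain m where "order G = r ^ 1 * m" by auto
  then obtain S where S: "subgroup S G" "card S = r"
    using sylow_thm[OF r(1) is_group _ fin, of 1 m] by auto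
  have "finite S" using S(1) fin finite_subset subgroup.subset by blast
  have "1 < card S" using S(2) r(1) prime_gt_1_nat by simp
  then obtain x where x: "x \<in> S" "x \<noteq> \<one>"
    by (metis One_nat_def S(1) subgroup.one_closed \<open>finite S\<close> card_le_Suc0_iff_eq not_less)
  have xG: "x \<in> carrier G" using x(1) S(1) subgroup.subset by blast
  interpret S: group "G\<lparr>carrier := S\<rparr>" using S(1) subgroup_imp_group by blast
  have "x [^] r = \<one>"
    using S.pow_order_eq_1[of x] x(1) S(2) nat_pow_consistent[of x r]
    by (simp add: order_def)
  then have "ord x dvd r" using pow_eq_id[OF xG] by blast
  moreover have "ord x \<noteq> 1" using ord_eq_1[OF xG] x(2) by simp
  ultimately have "r = ord x" using r(1) prime_nat_iff by metis
  moreover have "ord x dvd p ^ N" using tors[OF xG] pow_eq_id[OF xG] by blast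
  ultimately show "r = p"
    using r(1) p prime_dvd_power primes_dvd_imp_eq by blast
qed (use p in auto)

text \<open>In a finite field the power map with exponent the order of the field is the identity, and
  so are its iterates.\<close>

lemma (in field) pow_order_power:
  assumes fin: "finite (carrier R)" and a: "a \<in> carrier R"
  shows "a [^] (order R ^ j) = a"
proof -
  have step: "b [^] order R = b" if b: "b \<in> carrier R" for b
  proof (cases "b = \<zero>")
    case True
    then show ?thesis using fin order_gt_0_iff_finite by (simp add: nat_pow_zero)
  next
    case False
    then have bU: "b \<in> Units R" using b field_Units by blast
    interpret U: group "units_of R" by (rule units_group)
    have "order (units_of R) = order R - 1"
      using fin field_Units by (simp add: order_def units_of_carrier card_Diff_singleton)
    moreover have "b [^]\<^bsub>units_of R\<^esub> n = b [^] n" for n :: nat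
      using bU by (simp add: units_of_pow)
    ultimately have "b [^] (order R - 1) = \<one>"
      using U.pow_order_eq_1[of b] bU by (simp add: units_of_carrier units_of_one)
    moreover have "order R = Suc (order R - 1)"
      using fin order_gt_0_iff_finite by simp
    ultimately show ?thesis using b by (metis l_one nat_pow_Suc)
  qed
  show ?thesis
  proof (induction j)
    case 0
    then show ?case using a by simp
  next
    case (Suc j)
    have "a [^] (order R ^ Suc j) = (a [^] (order R ^ j)) [^] order R"
      using a by (simp add: nat_pow_pow mult.commute)
    then show ?case using Suc step a by simp
  qed
qed

section \<open>Powers and principal ideals in a commutative ring\<close>

text \<open>The binomial expansion of \<open>(1 + x) ^ n\<close>, recording only the linear coefficient.\<close>

lemma (in cring) one_plus_pow:
  assumes x: "x \<in> carrier R"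
  shows "\<exists>c\<in>carrier R. (\<one> \<oplus> x) [^] (n::nat) = \<one> \<oplus> x \<otimes> ([n] \<cdot> \<one> \<oplus> x \<otimes> c)"
proof (induction n)
  case 0
  show ?case using x by (intro bexI[of _ \<zero>]) auto
next
  case (Suc n)
  then obtain c where c: "c \<in> carrier R"
    and eq: "(\<one> \<oplus> x) [^] n = \<one> \<oplus> x \<otimes> ([n] \<cdot> \<one> \<oplus> x \<otimes> c)" by blast
  define t where "t = [n] \<cdot> \<one>"
  have t: "t \<in> carrier R" unfolding t_def by simp
  have "(\<one> \<oplus> x) [^] Suc n = (\<one> \<oplus> x \<otimes> (t \<oplus> x \<otimes> c)) \<otimes> (\<one> \<oplus> x)"
    using eq by (simp add: t_def)
  also have "\<dots> = \<one> \<oplus> x \<otimes> ((t \<oplus> \<one>) \<oplus> x \<otimes> (c \<oplus> t \<oplus> x \<otimes> c))"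
    using x c t by algebra
  also have "t \<oplus> \<one> = [Suc n] \<cdot> \<one>" by (simp add: t_def add.nat_pow_Suc)
  finally show ?case using x c t by blast
qed

text \<open>
  The first isomorphism theorem, as a count, for multiplication by \<open>a\<close> restricted to a subgroup
  \<open>S\<close> that contains the annihilator of \<open>a\<close>: every nonempty fibre is a coset of the annihilator.
\<close>

lemma (in cring) card_mult_image:
  assumes fin: "finite (carrier R)" and S: "additive_subgroup S R" and a: "a \<in> carrier R"
    and ann: "{r \<in> carrier R. r \<otimes> a = \<zero>} \<subseteq> S"
  shows "card ((\<lambda>r. r \<otimes> a) ` S) * card {r \<in> carrier R. r \<otimes> a = \<zero>} = card S"
proof -
  interpret S: additive_subgroup S R by (rule S)
  let ?N = "{r \<in> carrier R. r \<otimes> a = \<zero>}" and ?h = "\<lambda>r. r \<otimes> a"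
  have finS: "finite S" using S.a_subset fin finite_subset by blast
  have fibre: "card {r \<in> S. ?h r = y} = card ?N" if y: "y \<in> ?h ` S" for y
  proof -
    obtain s where s: "s \<in> S" "y = s \<otimes> a" using y by blast
    have sR: "s \<in> carrier R" using s(1) S.a_subset by blast
    have "bij_betw (\<lambda>r. r \<oplus> s) ?N {r \<in> S. ?h r = y}"
    proof (rule bij_betw_byWitness[where f' = "\<lambda>r. r \<ominus> s"])
      show "\<forall>r\<in>?N. r \<oplus> s \<ominus> s = r"
      proof
        fix r assume "r \<in> ?N"
        then have "r \<in> carrier R" by simp
        then show "r \<oplus> s \<ominus> s = r" using sR by algebra
      qed
      show "\<forall>r\<in>{r \<in> S. ?h r = y}. r \<ominus> s \<oplus> s = r"
      proof
        fix r assume "r \<in> {r \<in> S. ?h r = y}"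
        then have "r \<in> carrier R" using S.a_subset by auto
        then show "r \<ominus> s \<oplus> s = r" using sR by algebra
      qed
      show "(\<lambda>r. r \<oplus> s) ` ?N \<subseteq> {r \<in> S. ?h r = y}"
        using ann s sR a by (auto simp: l_distr)
      show "(\<lambda>r. r \<ominus> s) ` {r \<in> S. ?h r = y} \<subseteq> ?N"
      proof (rule image_subsetI)
        fix r assume "r \<in> {r \<in> S. ?h r = y}"
        then have r: "r \<in> S" "r \<otimes> a = y" by auto
        have rR: "r \<in> carrier R" using r(1) S.a_subset by blast
        have "(r \<ominus> s) \<otimes> a = r \<otimes> a \<ominus> s \<otimes> a" using rR sR a by algebra
        also have "\<dots> = \<zero>" using r(2) s(2) sR a by (simp add: minus_eq r_neg)
        finally show "r \<ominus> s \<in> ?N" using rR sR by simp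
      qed
    qed
    from bij_betw_same_card[OF this] show ?thesis by (rule sym)
  qed
  have "card S = (\<Sum>y\<in>?h ` S. card {r \<in> S. ?h r = y})"
    using sum.image_gen[OF finS, of "\<lambda>_. 1::nat" ?h] by simp
  also have "\<dots> = card (?h ` S) * card ?N" using fibre by simp
  finally show ?thesis by simp
qed

section \<open>Finite local rings\<close>

locale finite_local_ring = local_ring +
  assumes finite_carrier: "finite (carrier R)"
begin

text \<open>The maximal ideal of \<open>R\<close>; the description is proper because a local ring has exactly one.\<close>

definition max_ideal where "max_ideal = (THE M. maximalideal M R)"

lemma maximalideal_max_ideal: "maximalideal max_ideal R"
  unfolding max_ideal_def by (rule theI'[OF ex1_maximalideal])

sublocale M: maximalideal max_ideal R
  by (rule maximalideal_max_ideal)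

lemma residue_field_eq: "residue_field R = R Quot max_ideal"
  by (simp add: residue_field_def max_ideal_def)

lemma field_residue_field: "field (residue_field R)"
  unfolding residue_field_eq by (rule M.quotient_is_field[OF is_cring])

lemma nonunit_in_max_ideal:
  assumes a: "a \<in> carrier R" and nu: "a \<notin> Units R"
  shows "a \<in> max_ideal"
proof -
  let ?P = "{J. ideal J R \<and> J \<noteq> carrier R}"
  have "?P \<subseteq> Pow (carrier R)"
    by (auto dest: ideal.Icarr)
  then have "finite ?P" using finite_carrier finite_subset by blast
  moreover have "PIdl a \<in> ?P"
    using cgenideal_ideal[OF a] ideal_eq_carrier_iff[OF a] nu by auto
  \<comment> \<open>A largest proper ideal above the principal ideal of \<open>a\<close> exists since \<open>R\<close> is finite.\<close>
  ultimately obtain J where J: "J \<in> ?P" "PIdl a \<subseteq> J"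
    and max: "\<forall>K\<in>?P. J \<subseteq> K \<longrightarrow> J = K"
    using finite_has_maximal2[of ?P "PIdl a"] by auto
  have "maximalideal J R"
    by (rule maximalidealI) (use J max in auto)
  then have "J = max_ideal" using ex1_maximalideal maximalideal_max_ideal by blast
  then show ?thesis using J(2) cgenideal_self[OF a] by blast
qed

lemma Units_eq: "Units R = carrier R - max_ideal"
proof -
  have "a \<notin> max_ideal" if a: "a \<in> Units R" for a
  proof
    assume "a \<in> max_ideal"
    then have "inv a \<otimes> a \<in> max_ideal" using a by (intro M.I_l_closed Units_inv_closed)
    then have "\<one> \<in> max_ideal" using Units_l_inv[OF a] by metis
    then show False using M.one_imp_carrier M.I_notcarr by blast
  qed
  then show ?thesis using nonunit_in_max_ideal by auto
qed

lemma order_eq_residue_mult: "order R = order (residue_field R) * card max_ideal"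
  using a_lagrange[OF finite_carrier M.additive_subgroup_axioms]
  by (simp add: residue_field_eq order_def FactRing_def)

lemma card_Units: "card (Units R) = (order (residue_field R) - 1) * card max_ideal"
proof -
  have sub: "max_ideal \<subseteq> carrier R" by (rule M.a_subset)
  then have "card (Units R) = order R - card max_ideal"
    unfolding Units_eq order_def using finite_carrier finite_subset
    by (metis card_Diff_subset)
  then show ?thesis by (simp add: order_eq_residue_mult diff_mult_distrib)
qed

lemma finite_max_ideal: "finite max_ideal"
  using M.a_subset finite_carrier finite_subset by blast

lemma finite_residue_field: "finite (carrier (residue_field R))"
proof -
  have "order R > 0" using finite_carrier order_gt_0_iff_finite by blast
  then have "order (residue_field R) > 0" by (simp add: order_eq_residue_mult)
  then show ?thesis
    by (simp add: order_def card_gt_0_iff)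
qed

lemma residue_hom: "ring_hom_ring R (residue_field R) ((+>) max_ideal)"
  unfolding residue_field_eq by (rule M.rcos_ring_hom_ring)

lemma residue_nat:
  fixes n :: nat
  shows "max_ideal +> ([n] \<cdot> \<one>) =
    [n] \<cdot>\<^bsub>residue_field R\<^esub> \<one>\<^bsub>residue_field R\<^esub>"
proof -
  interpret h: ring_hom_ring R "residue_field R" "(+>) max_ideal" by (rule residue_hom)
  show ?thesis by (induction n) (simp_all add: h.S.add.nat_pow_Suc)
qed

lemma residue_eq_zero_iff:
  assumes "a \<in> carrier R"
  shows "max_ideal +> a = \<zero>\<^bsub>residue_field R\<^esub> \<longleftrightarrow> a \<in> max_ideal"
  using assms a_rcos_zero[OF M.ideal_axioms] M.rcos_const_imp_mem
  by (auto simp: residue_field_eq FactRing_def)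

lemma one_notin_max_ideal: "\<one> \<notin> max_ideal"
  using Units_eq by blast

lemma order_residue_field_gt_1: "1 < order (residue_field R)"
proof -
  interpret K: field "residue_field R" by (rule field_residue_field)
  have "card {\<zero>\<^bsub>residue_field R\<^esub>, \<one>\<^bsub>residue_field R\<^esub>} \<le> order (residue_field R)"
    unfolding order_def by (rule card_mono[OF finite_residue_field]) auto
  then show ?thesis using K.zero_not_one by simp
qed

text \<open>Two powers of \<open>a\<close> coincide by finiteness, \<open>a ^ i = a ^ j\<close> with \<open>i < j\<close>. Then
  \<open>a ^ i * (1 - a ^ (j - i)) = 0\<close>, and the second factor is a unit.\<close>

lemma max_ideal_nilpotent:
  assumes a: "a \<in> max_ideal"
  obtains N :: nat where "a [^] N = \<zero>"
proof -
  have aR: "a \<in> carrier R" using a M.Icarr by blast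
  have "range (\<lambda>i::nat. a [^] i) \<subseteq> carrier R" using aR by auto
  then have "\<not> inj (\<lambda>i::nat. a [^] i)"
    using finite_carrier finite_subset range_inj_infinite by blast
  then obtain i j :: nat where ij: "a [^] i = a [^] j" "i < j"
    unfolding inj_def by (metis nat_neq_iff)
  define b where "b = a [^] (j - i)"
  have bM: "b \<in> max_ideal"
  proof -
    obtain d where "j - i = Suc d" using ij(2) by (metis Suc_diff_Suc)
    then have "b = a [^] d \<otimes> a" by (simp add: b_def)
    then show ?thesis using a aR M.I_l_closed by simp
  qed
  then have bR: "b \<in> carrier R" using M.Icarr by blast
  have "\<one> \<ominus> b \<notin> max_ideal"
  proof
    assume "\<one> \<ominus> b \<in> max_ideal"
    then have "(\<one> \<ominus> b) \<oplus> b \<in> max_ideal" using bM by (rule M.a_closed)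
    moreover have "(\<one> \<ominus> b) \<oplus> b = \<one>" using bR by algebra
    ultimately show False using one_notin_max_ideal by simp
  qed
  then have u: "\<one> \<ominus> b \<in> Units R" using bR Units_eq by simp
  have "a [^] j = a [^] i \<otimes> b"
    using ij(2) aR by (simp add: b_def nat_pow_mult)
  moreover have "a [^] i \<otimes> (\<one> \<ominus> b) = a [^] i \<ominus> a [^] i \<otimes> b"
    using bR nat_pow_closed[OF aR, of i] by algebra
  ultimately have "a [^] i \<otimes> (\<one> \<ominus> b) = \<zero>"
    using ij(1) nat_pow_closed[OF aR, of j] by (simp add: minus_eq r_neg)
  then have "a [^] i \<otimes> (\<one> \<ominus> b) \<otimes> inv (\<one> \<ominus> b) = \<zero>" using u by simp
  then have "a [^] i = \<zero>"
    using u nat_pow_closed[OF aR, of i] by (metis Units_closed Units_inv_closed Units_r_inv m_assoc r_one)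
  then show thesis by (rule that)
qed

lemma order_prime_power_if_residue_char:
  fixes p :: nat
  assumes p: "Factorial_Ring.prime p" and pM: "[p] \<cdot> \<one> \<in> max_ideal"
  obtains n where "order R = p ^ n"
proof -
  obtain N :: nat where N: "([p] \<cdot> \<one>) [^] N = \<zero>" using max_ideal_nilpotent[OF pM] .
  have pow: "([p] \<cdot> \<one>) [^] i = [(p ^ i)] \<cdot> \<one>" for i :: nat
  proof (induction i)
    case (Suc i)
    then show ?case
      by (simp add: add_pow_ldistr add.nat_pow_pow mult.commute)
  qed simp
  have tors: "[(p ^ N)] \<cdot> x = \<zero>" if x: "x \<in> carrier R" for x
    using add_pow_ldistr[of \<one> x "p ^ N"] N pow[of N] x by simp
  show thesis
  proof (rule group.order_prime_power[of "add_monoid R" p N])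
    show "group (add_monoid R)" by (rule a_group)
    show "finite (carrier (add_monoid R))" using finite_carrier by simp
    show "x [^]\<^bsub>add_monoid R\<^esub> (p ^ N) = \<one>\<^bsub>add_monoid R\<^esub>" if "x \<in> carrier (add_monoid R)" for x
      using tors[of x] that by (simp add: add_pow_def)
  qed (use p that in \<open>auto simp: order_def\<close>)
qed

text \<open>For nonzero \<open>a\<close>, multiplication by \<open>a\<close> has the same kernel on \<open>R\<close> as on the maximal ideal,
  because no unit annihilates \<open>a\<close>.\<close>

lemma card_principal_ideal:
  assumes a: "a \<in> carrier R" "a \<noteq> \<zero>"
  shows "card ((\<lambda>r. r \<otimes> a) ` carrier R) =
    order (residue_field R) * card ((\<lambda>r. r \<otimes> a) ` max_ideal)"
proof -
  let ?N = "{r \<in> carrier R. r \<otimes> a = \<zero>}"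
  have N: "?N \<subseteq> max_ideal"
  proof clarify
    fix r assume r: "r \<in> carrier R" "r \<otimes> a = \<zero>"
    have "r \<notin> Units R"
    proof
      assume "r \<in> Units R"
      then have "a = inv r \<otimes> (r \<otimes> a)" using a r(1) by (simp add: m_assoc[symmetric])
      then show False using r(2) a \<open>r \<in> Units R\<close> by simp
    qed
    then show "r \<in> max_ideal" using nonunit_in_max_ideal r(1) by blast
  qed
  have "additive_subgroup (carrier R) R"
    using ideal.axioms(1)[OF oneideal] .
  then have "card ((\<lambda>r. r \<otimes> a) ` carrier R) * card ?N = order R"
    using card_mult_image[OF finite_carrier _ a(1)] by (simp add: order_def)
  moreover have "card ((\<lambda>r. r \<otimes> a) ` max_ideal) * card ?N = card max_ideal"
    using card_mult_image[OF finite_carrier M.additive_subgroup_axioms a(1) N] .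
  moreover have "card ?N > 0"
  proof -
    have "\<zero> \<in> ?N" using a(1) by simp
    then show ?thesis using finite_carrier card_gt_0_iff by fastforce
  qed
  ultimately have "card ((\<lambda>r. r \<otimes> a) ` carrier R) * card ?N =
      (order (residue_field R) * card ((\<lambda>r. r \<otimes> a) ` max_ideal)) * card ?N"
    using order_eq_residue_mult by simp
  with \<open>card ?N > 0\<close> show ?thesis by simp
qed

text \<open>The bound on the exponent: the principal ideals generated by
  \<open>(1 + x) ^ (p ^ i) - 1\<close> shrink too fast for the last of these elements to be nonzero.\<close>

lemma one_plus_max_ideal_pow:
  fixes p k :: nat
  assumes pM: "[p] \<cdot> \<one> \<in> max_ideal" and x: "x \<in> max_ideal"
    and card: "card max_ideal < order (residue_field R) ^ Suc k"
  shows "(\<one> \<oplus> x) [^] (p ^ k) = \<one>"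
proof (rule ccontr)
  assume nontriv: "(\<one> \<oplus> x) [^] (p ^ k) \<noteq> \<one>"
  define Q where "Q = order (residue_field R)"
  define y where "y i = (\<one> \<oplus> x) [^] (p ^ i) \<ominus> \<one>" for i
  define I where "I i = (\<lambda>r. r \<otimes> y i) ` carrier R" for i
  have xR: "x \<in> carrier R" using x M.Icarr by blast
  have yR: "y i \<in> carrier R" for i unfolding y_def using xR by (intro minus_closed nat_pow_closed a_closed one_closed)
  have pow_eq: "(\<one> \<oplus> x) [^] (p ^ i) = \<one> \<oplus> y i" for i
  proof -
    have "(\<one> \<oplus> x) [^] (p ^ i) \<in> carrier R" using xR by simp
    then show ?thesis unfolding y_def by algebra
  qed
  have y0: "y 0 = x"
  proof -
    have "y 0 = \<one> \<oplus> x \<ominus> \<one>" using xR by (simp add: y_def)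
    then show ?thesis using xR by algebra
  qed
  have y_Suc: "\<exists>m\<in>max_ideal. y (Suc i) = y i \<otimes> m" if yi: "y i \<in> max_ideal" for i
  proof -
    obtain c where c: "c \<in> carrier R"
      and eq: "(\<one> \<oplus> y i) [^] p = \<one> \<oplus> y i \<otimes> ([p] \<cdot> \<one> \<oplus> y i \<otimes> c)"
      using one_plus_pow[OF yR] by blast
    define m where "m = [p] \<cdot> \<one> \<oplus> y i \<otimes> c"
    have m: "m \<in> max_ideal"
      unfolding m_def using pM M.I_r_closed[OF yi c] by (rule M.a_closed)
    then have mR: "m \<in> carrier R" using M.Icarr by blast
    have "(\<one> \<oplus> x) [^] (p ^ Suc i) = ((\<one> \<oplus> x) [^] (p ^ i)) [^] p"
      using xR by (simp add: nat_pow_pow mult.commute)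
    also have "\<dots> = \<one> \<oplus> y i \<otimes> m" using eq by (simp add: pow_eq m_def)
    finally have "y (Suc i) = \<one> \<oplus> y i \<otimes> m \<ominus> \<one>" by (simp add: y_def)
    also have "\<dots> = y i \<otimes> m" using yR[of i] mR by algebra
    finally show ?thesis using m by blast
  qed
  have yM: "y i \<in> max_ideal" for i
  proof (induction i)
    case 0
    then show ?case using y0 x by simp
  next
    case (Suc i)
    then show ?case using y_Suc[OF Suc] M.I_l_closed[OF _ yR] by auto
  qed
  \<comment> \<open>A zero would persist, whereas \<open>y k\<close> is nonzero.\<close>
  have ynz: "y i \<noteq> \<zero>" if "i \<le> k" for i
    using that
  proof (induction i rule: inc_induct)
    case base
    show ?case
    proof
      assume "y k = \<zero>"
      then show False using nontriv pow_eq[of k] by simp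
    qed
  next
    case (step n)
    then show ?case using y_Suc[OF yM[of n]] M.Icarr by auto
  qed
  have finI: "finite (I i)" for i unfolding I_def using finite_carrier by simp
  have drop: "Q * card (I (Suc i)) \<le> card (I i)" if i: "i \<le> k" for i
  proof -
    obtain m where m: "m \<in> max_ideal" "y (Suc i) = y i \<otimes> m" using y_Suc[OF yM] by blast
    have mR: "m \<in> carrier R" using m(1) M.Icarr by blast
    have "I (Suc i) \<subseteq> (\<lambda>r. r \<otimes> y i) ` max_ideal"
    proof
      fix z assume "z \<in> I (Suc i)"
      then obtain r where r: "r \<in> carrier R" "z = r \<otimes> (y i \<otimes> m)" using m(2) I_def by auto
      then have "z = (r \<otimes> m) \<otimes> y i" using yR[of i] mR by algebra
      then show "z \<in> (\<lambda>r. r \<otimes> y i) ` max_ideal" using M.I_l_closed[OF m(1) r(1)] by blast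
    qed
    then have "card (I (Suc i)) \<le> card ((\<lambda>r. r \<otimes> y i) ` max_ideal)"
      using finite_max_ideal by (simp add: card_mono)
    then show ?thesis
      using card_principal_ideal[OF yR ynz[OF i]] by (simp add: I_def Q_def)
  qed
  have "Q ^ i * card (I i) \<le> card max_ideal" if "i \<le> Suc k" for i
    using that
  proof (induction i)
    case 0
    have "I 0 \<subseteq> max_ideal" unfolding I_def using M.I_l_closed[OF yM] by auto
    then show ?case using finite_max_ideal by (simp add: card_mono)
  next
    case (Suc i)
    then have "Q ^ i * (Q * card (I (Suc i))) \<le> Q ^ i * card (I i)"
      by (intro mult_le_mono2 drop) simp
    also have "\<dots> \<le> card max_ideal" using Suc by simp
    finally show ?case by (simp add: algebra_simps)
  qed
  from this[of "Suc k"] have "Q ^ Suc k * card (I (Suc k)) \<le> card max_ideal" by blast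
  moreover have "0 < card (I (Suc k))" using finI by (auto simp: card_gt_0_iff I_def)
  ultimately have "Q ^ Suc k \<le> card max_ideal"
    by (metis le_trans mult.right_neutral mult_le_mono2 Suc_leI One_nat_def)
  then show False using card by (simp add: Q_def)
qed

text \<open>The number of units determines the orders of the maximal ideal and of the residue field,
  since \<open>p ^ c - 1\<close> is prime to \<open>p\<close>.\<close>

lemma card_max_ideal_and_residue_field:
  fixes p l n :: nat
  assumes p: "Factorial_Ring.prime p" and pM: "[p] \<cdot> \<one> \<in> max_ideal"
    and l: "0 < l" and card: "card (Units R) = (p ^ l - 1) * p ^ n"
  shows "card max_ideal = p ^ n" "order (residue_field R) = p ^ l"
proof -
  let ?Q = "order (residue_field R)" and ?M = "card max_ideal"
  have p1: "1 < p" using p prime_gt_1_nat by blast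
  obtain N where "order R = p ^ N" using order_prime_power_if_residue_char[OF p pM] .
  then have QM: "?Q * ?M = p ^ N" using order_eq_residue_mult by simp
  obtain b where b: "?M = p ^ b"
    using divides_primepow_nat[OF p] QM by (metis dvd_triv_right)
  obtain a where a: "?Q = p ^ a"
    using divides_primepow_nat[OF p] QM by (metis dvd_triv_left)
  have "a > 0" using a order_residue_field_gt_1 by (cases a) auto
  have cop: "\<not> p dvd p ^ c - 1" if "0 < c" for c :: nat
  proof
    assume "p dvd p ^ c - 1"
    moreover have "p dvd p ^ c" using that by simp
    moreover have "1 \<le> p ^ c" using p1 by simp
    ultimately have "p dvd 1" using dvd_diffD1 by blast
    then show False using p1 by simp
  qed
  have pos: "p ^ c - 1 \<noteq> 0" if "0 < c" for c :: nat
    using cop[OF that] by (metis dvd_0_right)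
  have mult: "multiplicity p ((p ^ c - 1) * p ^ d) = d" if "0 < c" for c d :: nat
    using p cop[OF that] pos[OF that] p1
    by (simp add: prime_elem_multiplicity_mult_distrib not_dvd_imp_multiplicity_0)
  have eq: "(p ^ a - 1) * p ^ b = (p ^ l - 1) * p ^ n"
    using card card_Units a b by simp
  have "b = n" using mult[OF \<open>a > 0\<close>, of b] mult[OF l, of n] eq by simp
  then show "?M = p ^ n" using b by simp
  have "p ^ a - 1 = p ^ l - 1" using eq \<open>b = n\<close> p1 by simp
  moreover have "1 \<le> p ^ a" "1 \<le> p ^ l" using p1 by simp_all
  ultimately show "?Q = p ^ l" using a by (metis le_add_diff_inverse)
qed

lemma unit_in_one_plus_max_ideal:
  assumes u: "u \<in> Units R" and pow: "u [^] (order (residue_field R) ^ k) = \<one>"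
  shows "u \<ominus> \<one> \<in> max_ideal"
proof -
  interpret K: field "residue_field R" by (rule field_residue_field)
  interpret h: ring_hom_ring R "residue_field R" "(+>) max_ideal" by (rule residue_hom)
  have uR: "u \<in> carrier R" using u by blast
  have "max_ideal +> u = (max_ideal +> u) [^]\<^bsub>residue_field R\<^esub> (order (residue_field R) ^ k)"
    using K.pow_order_power[OF finite_residue_field] uR by simp
  also have "\<dots> = max_ideal +> (u [^] (order (residue_field R) ^ k))"
    using uR by (simp add: h.hom_nat_pow)
  also have "\<dots> = max_ideal +> \<one>" using pow by simp
  finally show ?thesis
    using quotient_eq_iff_same_a_r_cos[OF M.ideal_axioms uR one_closed] by simp
qed

end

section \<open>The exponent of the \<open>p\<close>-part of the unit group\<close>

theorem proposition4p1:
  fixes p k l :: nat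
    and F :: "'f ring"
    and H :: "'h monoid"
  assumes "Factorial_Ring.prime p" and "0 < k" and "0 < l"
    and "field F" and "order F = p ^ l"
    and "comm_group H" and "p_group p H" and "order H = p ^ (l * k)"
    and "\<exists>A :: 'a ring.
           finite (carrier A) \<and> local_ring A \<and> artinian_ring A \<and>
           [p] \<cdot>\<^bsub>residue_field A\<^esub> \<one>\<^bsub>residue_field A\<^esub> = \<zero>\<^bsub>residue_field A\<^esub> \<and>
           units_of A \<cong> units_of F \<times>\<times> H"
  shows "group_exponent H \<le> p ^ k"
proof -
  obtain A :: "'a ring" where A: "finite (carrier A)" "local_ring A"
    and char: "[p] \<cdot>\<^bsub>residue_field A\<^esub> \<one>\<^bsub>residue_field A\<^esub> = \<zero>\<^bsub>residue_field A\<^esub>"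
    and iso: "units_of A \<cong> units_of F \<times>\<times> H"
    using assms(9) by blast
  interpret A: finite_local_ring A
    using A by (simp add: finite_local_ring_def finite_local_ring_axioms_def)
  interpret F: field F by (rule assms(4))
  interpret H: comm_group H by (rule assms(6))
  interpret UA: group "units_of A" by (rule A.units_group)
  interpret UF: group "units_of F" by (rule F.units_group)
  have p1: "1 < p" using assms(1) prime_gt_1_nat by blast
  have pM: "[p] \<cdot>\<^bsub>A\<^esub> \<one>\<^bsub>A\<^esub> \<in> A.max_ideal"
    using A.residue_eq_zero_iff[of "[p] \<cdot>\<^bsub>A\<^esub> \<one>\<^bsub>A\<^esub>"] A.residue_nat[of p] char by simp
  have "finite (carrier F)"
    using assms(5) p1 F.order_gt_0_iff_finite by simp
  then have "card (Units F) = p ^ l - 1"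
    using assms(5) F.field_Units by (simp add: order_def card_Diff_singleton)
  then have "card (Units A) = (p ^ l - 1) * p ^ (l * k)"
    using iso_same_card[OF iso] assms(8)
    by (simp add: units_of_carrier DirProd_def card_cartesian_product order_def)
  note cards = A.card_max_ideal_and_residue_field[OF assms(1) pM assms(3) this]
  have UA_pow: "u [^]\<^bsub>units_of A\<^esub> n = u [^]\<^bsub>A\<^esub> n" if "u \<in> Units A" for u and n :: nat
    using that by (simp add: A.units_of_pow)

  obtain f where f: "f \<in> iso (units_of F \<times>\<times> H) (units_of A)"
    using UA.iso_sym[OF iso] unfolding is_iso_def by blast
  \<comment> \<open>The embedding of \<open>H\<close> into the unit group of \<open>A\<close> as the second factor.\<close>
  define g where "g x = f (\<one>\<^bsub>F\<^esub>, x)" for x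
  have ghom: "g \<in> hom H (units_of A)"
  proof (rule homI)
    have fh: "f \<in> hom (units_of F \<times>\<times> H) (units_of A)" using f by (simp add: iso_def)
    show "g x \<in> carrier (units_of A)" if "x \<in> carrier H" for x
      using hom_in_carrier[OF fh, of "(\<one>\<^bsub>F\<^esub>, x)"] that by (simp add: g_def units_of_carrier)
    show "g (x \<otimes>\<^bsub>H\<^esub> y) = g x \<otimes>\<^bsub>units_of A\<^esub> g y" if "x \<in> carrier H" "y \<in> carrier H" for x y
      using hom_mult[OF fh, of "(\<one>\<^bsub>F\<^esub>, x)" "(\<one>\<^bsub>F\<^esub>, y)"] that
      by (simp add: g_def units_of_carrier units_of_mult)
  qed
  interpret g: group_hom H "units_of A" g
    by (intro group_hom.intro group_hom_axioms.intro ghom UA.is_group H.is_group)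
  have ginj: "inj_on g (carrier H)"
  proof (rule inj_onI)
    fix x y assume xy: "x \<in> carrier H" "y \<in> carrier H" "g x = g y"
    have "inj_on f (carrier (units_of F \<times>\<times> H))"
      using f by (simp add: iso_def bij_betw_def)
    then have "(\<one>\<^bsub>F\<^esub>, x) = (\<one>\<^bsub>F\<^esub>, y)"
      by (rule inj_onD) (use xy in \<open>simp_all add: g_def units_of_carrier\<close>)
    then show "x = y" by simp
  qed

  have "x [^]\<^bsub>H\<^esub> (p ^ k) = \<one>\<^bsub>H\<^esub>" if x: "x \<in> carrier H" for x
  proof -
    have u: "g x \<in> Units A" using g.hom_closed[OF x] by (simp add: units_of_carrier)
    have gpow: "g x [^]\<^bsub>A\<^esub> n = g (x [^]\<^bsub>H\<^esub> n)" for n :: nat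
      using g.hom_nat_pow[OF x, of n] UA_pow[OF u, of n] by simp
    have gone: "g \<one>\<^bsub>H\<^esub> = \<one>\<^bsub>A\<^esub>" using g.hom_one by (simp add: units_of_one)
    have "g x [^]\<^bsub>A\<^esub> (order (residue_field A) ^ k) = \<one>\<^bsub>A\<^esub>"
      using gpow[of "order H"] H.pow_order_eq_1[OF x] gone assms(8) cards(2)
      by (simp add: power_mult)
    then have m: "g x \<ominus>\<^bsub>A\<^esub> \<one>\<^bsub>A\<^esub> \<in> A.max_ideal"
      by (rule A.unit_in_one_plus_max_ideal[OF u])
    have "g x \<in> carrier A" using u by blast
    then have "\<one>\<^bsub>A\<^esub> \<oplus>\<^bsub>A\<^esub> (g x \<ominus>\<^bsub>A\<^esub> \<one>\<^bsub>A\<^esub>) = g x" by algebra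
    moreover have "card A.max_ideal < order (residue_field A) ^ Suc k"
      using cards p1 assms(3) A.order_residue_field_gt_1 by (simp add: power_mult)
    ultimately have "g x [^]\<^bsub>A\<^esub> (p ^ k) = \<one>\<^bsub>A\<^esub>"
      using A.one_plus_max_ideal_pow[OF pM m, of k] by simp
    then have "g (x [^]\<^bsub>H\<^esub> (p ^ k)) = g \<one>\<^bsub>H\<^esub>" using gpow gone by simp
    then show ?thesis using inj_onD[OF ginj] x by simp
  qed
  then show ?thesis
    unfolding group_exponent_def using p1 by (intro Least_le) simp
qed

end
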